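(* Consider the binary voting model and the Wisdom-of-the-Crowd-Voting mechanism defined in the context, and let $c=\frac13\min\{T_{\ell h}-P_{\ell H},\;T_{\ell\ell}-T_{\ell h},\;P_{\ell L}-T_{\ell\ell},\;P_{hH}-T_{hh},\;T_{hh}-T_{h\ell},\;T_{h\ell}-P_{hL}\}$. Then the truthful strategy profile is an $\varepsilon$-strong Bayes Nash equilibrium of the mechanism, where $\varepsilon=(2B^2+4B)\exp(-2c^2\alpha_C T)$.
   Context: Model. There are $T$ agents ($T$ odd), two alternatives $\mathbf A$ (accept) and $\mathbf R$ (reject), and two worlds $L,H$. The actual world $W$ is random with $\Pr(W=L)=P_L>0$, $\Pr(W=H)=P_H>0$, $P_L+P_H=1$. Given $W$, the agents receive conditionally i.i.d. private signals $S_t\in\{\ell,h\}$ with $P_{mn}=\Pr(S_t=m\mid W=n)$, where $P_{\ell L}>P_{\ell H}$ and $P_{hH}>P_{hL}$. All these parameters are common knowledge. Posterior prediction. For $m,m'\in\{\ell,h\}$, $T_{m'm}=\frac{P_LP_{mL}}{P_LP_{mL}+P_HP_{mH}}P_{m'L}+\frac{P_HP_{mH}}{P_LP_{mL}+P_HP_{mH}}P_{m'H}$, the probability an agent with signal $m$ assigns to another agent receiving signal $m'$. Utilities. Agent $t$ has $v_t:\{L,H\}\times\{\mathbf A,\mathbf R\}\to\{0,1,\dots,B\}$ ($B$ a positive integer) with $v_t(H,\mathbf A)>v_t(L,\mathbf A)$, $v_t(H,\mathbf R)<v_t(L,\mathbf R)$, $v_t(L,\mathbf A)\ne v_t(L,\mathbf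 R)$, $v_t(H,\mathbf A)\neq v_t(H,\mathbf R)$. Each agent has one of three types: $F$ (candidate-friendly) if $v_t(n,\mathbf A)>v_t(n,\mathbf R)$ for both $n\in\{L,H\}$; $U$ (candidate-unfriendly) if $v_t(n,\mathbf R)>v_t(n,\mathbf A)$ for both $n$; $C$ (contingent) if $v_t(L,\mathbf R)>v_t(L,\mathbf A)$ and $v_t(H,\mathbf A)>v_t(H,\mathbf R)$. The fractions of agents of types $F,U,C$ are $\alpha_F,\alpha_U,\alpha_C$; they are common knowledge. Mechanism. Each agent reports a type in $\{F,U,C\}$; an agent reporting $C$ also reports a signal $\bar s_t\in\{\ell,h\}$ and a prediction $\bar\delta_t\in[0,1]$ of the fraction of agents whose (treated) reported signal is $h$. For an agent reporting $F$ the mechanism sets $\bar s_t=h$, $\bar\delta_t=0$; for an agent reporting $U$ it sets $\bar s_t=\ell$, $\bar\delta_t=1$. Let $\bar\delta$ be the median of all $\bar\delta_t$. If more than half of the agents report $F$, output $\mathbf A$; if more than half report $U$, output $\mathbf R$; otherwise output $\mathbf A$ if the fraction of agents with $\bar s_t=h$ is more than $\bar\delta$, and $\mathbf R$ otherwise. Strategies. A strategy of an agent is a (possibly random) map $\sigma$ from signals $\{\ell,h\}$ to reports. The truthful strategy: report the true type; a type $C$ agent with signal $m$ reports $\bar s_t=m$ and $\bar\delta_t=\alpha_F+\alpha_CT_{hm}$. For a profile $\Sigma=(\sigma_1,\dots,\sigma_T)$, let $\lambda_n^{\mathbf A}(\Sigma)$ and $\lambda_n^{\mathbf R}(\Sigma)=1-\lambda_n^{\mathbf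 A}(\Sigma)$ be the probabilities that $\mathbf A$, resp. $\mathbf R$, is output given $W=n$. The (ex-ante) utility of $t$ is $u_t(\Sigma)=\sum_{n\in\{L,H\}}P_n\big(\lambda_n^{\mathbf A}(\Sigma)v_t(n,\mathbf A)+\lambda_n^{\mathbf R}(\Sigma)v_t(n,\mathbf R)\big)$. Equilibrium. $\Sigma=(\sigma_1,\dots,\sigma_T)$ is an $\varepsilon$-strong Bayes Nash equilibrium if there do not exist a subset $D$ of agents and a profile $\Sigma'=(\sigma'_1,\dots,\sigma'_T)$ such that (1) $\sigma_t=\sigma_t'$ for all $t\notin D$; (2) $u_t(\Sigma')\ge u_t(\Sigma)$ for all $t\in D$; (3) $u_t(\Sigma')>u_t(\Sigma)+\varepsilon$ for some $t\in D$. *)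

theory Defs
  imports "HOL-Probability.Probability"
begin

datatype world = WL | WH
datatype signal = SigL | SigH
datatype alternative = Accept | Reject
datatype atype = Friendly | Unfriendly | Contingent

datatype report = RepF | RepU | RepC signal real

type_synonym valuation = "world \<Rightarrow> alternative \<Rightarrow> nat"

text \<open>Agents are the numbers below \<open>T\<close>. The law of the world is \<open>pW\<close>, and \<open>pS n\<close> is the law of
  one private signal given the world \<open>n\<close>. The paper's \<open>P\<^sub>n\<close> is \<open>pmf pW n\<close> and its \<open>P\<^sub>m\<^sub>n\<close> is
  \<open>pmf (pS n) m\<close>.\<close>

text \<open>\<open>post_pred pW pS m' m\<close> is \<open>T\<^sub>m\<^sub>'\<^sub>m\<close>; the second index is the agent's own signal.\<close>

definition post_pred :: "world pmf \<Rightarrow> (world \<Rightarrow> signal pmf) \<Rightarrow> signal \<Rightarrow> signal \<Rightarrow> real" where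
  "post_pred pW pS m' m =
     (let z = pmf pW WL * pmf (pS WL) m + pmf pW WH * pmf (pS WH) m
      in pmf pW WL * pmf (pS WL) m / z * pmf (pS WL) m'
       + pmf pW WH * pmf (pS WH) m / z * pmf (pS WH) m')"

definition admissible :: "nat \<Rightarrow> valuation \<Rightarrow> bool" where
  "admissible B u \<longleftrightarrow>
     (\<forall>n a. u n a \<le> B) \<and>
     u WH Accept > u WL Accept \<and> u WH Reject < u WL Reject \<and>
     u WL Accept \<noteq> u WL Reject \<and> u WH Accept \<noteq> u WH Reject"

primrec has_type :: "valuation \<Rightarrow> atype \<Rightarrow> bool" where
  "has_type u Friendly \<longleftrightarrow> (\<forall>n. u n Accept > u n Reject)"
| "has_type u Unfriendly \<longleftrightarrow> (\<forall>n. u n Reject > u n Accept)"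
| "has_type u Contingent \<longleftrightarrow> u WL Reject > u WL Accept \<and> u WH Accept > u WH Reject"

lemma all_world: "(\<forall>n. P n) \<longleftrightarrow> P WL \<and> P WH"
  by (metis world.exhaust)

lemma has_type_ex1:
  assumes "admissible B u"
  shows "\<exists>!\<tau>. has_type u \<tau>"
proof -
  have "\<exists>\<tau>. has_type u \<tau>"
  proof (rule ccontr)
    assume "\<nexists>\<tau>. has_type u \<tau>"
    then have "\<not> has_type u Friendly" "\<not> has_type u Unfriendly" "\<not> has_type u Contingent"
      by blast+
    then show False using assms by (auto simp: admissible_def all_world)
  qed
  moreover have "\<sigma> = \<tau>" if "has_type u \<sigma>" "has_type u \<tau>" for \<sigma> \<tau>
    using that by (cases \<sigma>; cases \<tau>) (auto simp: all_world)
  ultimately show ?thesis by blast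
qed

definition agent_type :: "valuation \<Rightarrow> atype" where
  "agent_type u = (THE \<tau>. has_type u \<tau>)"

definition type_frac :: "nat \<Rightarrow> (nat \<Rightarrow> valuation) \<Rightarrow> atype \<Rightarrow> real" where
  "type_frac T v \<tau> = real (card {t \<in> {..<T}. agent_type (v t) = \<tau>}) / real T"

subsection \<open>The mechanism\<close>

fun treated_signal :: "report \<Rightarrow> signal" where
  "treated_signal RepF = SigH"
| "treated_signal RepU = SigL"
| "treated_signal (RepC s d) = s"

fun treated_pred :: "report \<Rightarrow> real" where
  "treated_pred RepF = 0"
| "treated_pred RepU = 1"
| "treated_pred (RepC s d) = d"

text \<open>For odd \<open>T\<close> the median of \<open>T\<close> numbers is the middle entry of the sorted list.\<close>

definition median_pred :: "nat \<Rightarrow> (nat \<Rightarrow> report) \<Rightarrow> real" where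
  "median_pred T r = sort (map (\<lambda>t. treated_pred (r t)) [0..<T]) ! (T div 2)"

definition outcome :: "nat \<Rightarrow> (nat \<Rightarrow> report) \<Rightarrow> alternative" where
  "outcome T r =
     (if real (card {t \<in> {..<T}. r t = RepF}) > real T / 2 then Accept
      else if real (card {t \<in> {..<T}. r t = RepU}) > real T / 2 then Reject
      else if real (card {t \<in> {..<T}. treated_signal (r t) = SigH}) / real T > median_pred T r
      then Accept else Reject)"

subsection \<open>Strategies\<close>

definition reports :: "report set" where
  "reports = {RepF, RepU} \<union> {RepC s d | s d. d \<in> {0..1}}"

definition report_space :: "report measure" where
  "report_space = sigma reports
     ({{RepF}, {RepU}} \<union> {RepC s ` E | s E. E \<in> sets borel \<and> E \<subseteq> {0..1}})"

text \<open>Strategies may randomise by an arbitrary probability measure on reports, so predictions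
  may have a continuous distribution. Agents randomise independently of each other.\<close>

type_synonym strategy = "signal \<Rightarrow> report measure"

definition is_profile :: "nat \<Rightarrow> (nat \<Rightarrow> strategy) \<Rightarrow> bool" where
  "is_profile T \<Sigma> \<longleftrightarrow> (\<forall>t<T. \<forall>m. \<Sigma> t m \<in> space (prob_algebra report_space))"

definition truthful_report ::
    "nat \<Rightarrow> world pmf \<Rightarrow> (world \<Rightarrow> signal pmf) \<Rightarrow> (nat \<Rightarrow> valuation) \<Rightarrow> nat \<Rightarrow> signal \<Rightarrow> report" where
  "truthful_report T pW pS v t m =
     (case agent_type (v t) of
        Friendly \<Rightarrow> RepF
      | Unfriendly \<Rightarrow> RepU
      | Contingent \<Rightarrow>
          RepC m (type_frac T v Friendly + type_frac T v Contingent * post_pred pW pS SigH m))"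

definition truthful ::
    "nat \<Rightarrow> world pmf \<Rightarrow> (world \<Rightarrow> signal pmf) \<Rightarrow> (nat \<Rightarrow> valuation) \<Rightarrow> nat \<Rightarrow> strategy" where
  "truthful T pW pS v t m = return report_space (truthful_report T pW pS v t m)"

text \<open>\<open>accept_prob T pS \<Sigma> n\<close> is \<open>\<lambda>\<^sub>n\<^sup>A(\<Sigma>)\<close>: the signals are drawn i.i.d. from \<open>pS n\<close>, and then the
  reports independently from the measures \<open>\<Sigma> t (s t)\<close>. The event is measurable, see
  \<open>accept_event_measurable\<close> below.\<close>

definition accept_prob ::
    "nat \<Rightarrow> (world \<Rightarrow> signal pmf) \<Rightarrow> (nat \<Rightarrow> strategy) \<Rightarrow> world \<Rightarrow> real" where
  "accept_prob T pS \<Sigma> n =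
     measure_pmf.expectation (Pi_pmf {..<T} undefined (\<lambda>_. pS n))
       (\<lambda>s. measure (\<Pi>\<^sub>M t\<in>{..<T}. \<Sigma> t (s t))
              {r \<in> space (\<Pi>\<^sub>M t\<in>{..<T}. \<Sigma> t (s t)). outcome T r = Accept})"

definition reject_prob ::
    "nat \<Rightarrow> (world \<Rightarrow> signal pmf) \<Rightarrow> (nat \<Rightarrow> strategy) \<Rightarrow> world \<Rightarrow> real" where
  "reject_prob T pS \<Sigma> n = 1 - accept_prob T pS \<Sigma> n"

definition utility ::
    "nat \<Rightarrow> world pmf \<Rightarrow> (world \<Rightarrow> signal pmf) \<Rightarrow> (nat \<Rightarrow> valuation)
      \<Rightarrow> (nat \<Rightarrow> strategy) \<Rightarrow> nat \<Rightarrow> real" where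
  "utility T pW pS v \<Sigma> t =
     (\<Sum>n\<in>{WL, WH}. pmf pW n *
        (accept_prob T pS \<Sigma> n * real (v t n Accept) + reject_prob T pS \<Sigma> n * real (v t n Reject)))"

definition strong_BNE ::
    "nat \<Rightarrow> world pmf \<Rightarrow> (world \<Rightarrow> signal pmf) \<Rightarrow> (nat \<Rightarrow> valuation)
      \<Rightarrow> real \<Rightarrow> (nat \<Rightarrow> strategy) \<Rightarrow> bool" where
  "strong_BNE T pW pS v \<epsilon> \<Sigma> \<longleftrightarrow>
     is_profile T \<Sigma> \<and>
     \<not> (\<exists>D \<Sigma>'. D \<subseteq> {..<T} \<and> is_profile T \<Sigma>' \<and>
          (\<forall>t \<in> {..<T} - D. \<Sigma>' t = \<Sigma> t) \<and>
          (\<forall>t \<in> D. utility T pW pS v \<Sigma>' t \<ge> utility T pW pS v \<Sigma> t) \<and>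
          (\<exists>t \<in> D. utility T pW pS v \<Sigma>' t > utility T pW pS v \<Sigma> t + \<epsilon>))"

text \<open>The constant \<open>c\<close>; write \<open>P m n\<close> for \<open>P\<^sub>m\<^sub>n\<close> and \<open>Q m' m\<close> for \<open>T\<^sub>m\<^sub>'\<^sub>m\<close>.\<close>

definition gap_const :: "world pmf \<Rightarrow> (world \<Rightarrow> signal pmf) \<Rightarrow> real" where
  "gap_const pW pS =
     (let P = (\<lambda>m n. pmf (pS n) m); Q = post_pred pW pS
      in 1 / 3 * Min {Q SigL SigH - P SigL WH, Q SigL SigL - Q SigL SigH, P SigL WL - Q SigL SigL,
                      P SigH WH - Q SigH SigH, Q SigH SigH - Q SigH SigL, Q SigH SigL - P SigH WL})"

subsection \<open>Measurability of the acceptance event\<close>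

lemma report_gen_subset:
  "{{RepF}, {RepU}} \<union> {RepC s ` E | s E. E \<in> sets borel \<and> E \<subseteq> {0..1}} \<subseteq> Pow reports"
  by (auto simp: reports_def)

lemma space_report_space [simp]: "space report_space = reports"
  unfolding report_space_def using report_gen_subset by (rule space_measure_of)

lemma report_gen_sets:
  assumes "X \<in> {{RepF}, {RepU}} \<union> {RepC s ` E | s E. E \<in> sets borel \<and> E \<subseteq> {0..1}}"
  shows "X \<in> sets report_space"
  unfolding report_space_def using assms report_gen_subset by simp

lemma sets_report_space:
  "X \<in> sets report_space \<longleftrightarrow>
     X \<subseteq> reports \<and> (\<forall>s. {d \<in> {0..1}. RepC s d \<in> X} \<in> sets borel)" (is "_ \<longleftrightarrow> ?R")
proof
  assume X: "X \<in> sets report_space"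
  have "{d \<in> {0..1}. RepC s d \<in> X} \<in> sets borel" for s
  proof -
    have "RepC s \<in> restrict_space borel {0..1} \<rightarrow>\<^sub>M report_space"
      unfolding report_space_def
    proof (rule measurable_measure_of[OF report_gen_subset])
      show "RepC s \<in> space (restrict_space borel {0..1}) \<rightarrow> reports"
        by (auto simp: reports_def)
    next
      fix Y assume Y: "Y \<in> {{RepF}, {RepU}} \<union> {RepC s ` E | s E. E \<in> sets borel \<and> E \<subseteq> {0..1}}"
      then consider "Y = {RepF}" | "Y = {RepU}"
        | s' E where "Y = RepC s' ` E" "E \<in> sets borel" "E \<subseteq> {0..1}" by blast
      then show "RepC s -` Y \<inter> space (restrict_space borel {0..1})
          \<in> sets (restrict_space borel {0..1})"
      proof cases
        case (3 s' E)
        then have "RepC s -` Y \<inter> space (restrict_space borel {0..1}) = (if s = s' then E else {})"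
          by auto
        then show ?thesis using 3 by (simp add: sets_restrict_space_iff)
      qed (auto simp: vimage_def)
    qed
    from measurable_sets[OF this X] show ?thesis
      by (simp add: sets_restrict_space_iff vimage_def Int_def conj_commute)
  qed
  then show ?R using sets.sets_into_space[OF X] by simp
next
  assume R: ?R
  let ?E = "\<lambda>s. {d \<in> {0..1}. RepC s d \<in> X}"
  have eq: "X = (X \<inter> {RepF}) \<union> (X \<inter> {RepU}) \<union> RepC SigL ` ?E SigL \<union> RepC SigH ` ?E SigH" (is "_ = ?Y")
  proof (rule set_eqI)
    fix x show "x \<in> X \<longleftrightarrow> x \<in> ?Y"
    proof (cases x)
      case (RepC s d)
      then show ?thesis using R by (cases s) (auto simp: reports_def)
    qed auto
  qed
  have "RepC s ` ?E s \<in> sets report_space" for s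
  proof (rule report_gen_sets)
    have "?E s \<in> sets borel" "?E s \<subseteq> {0..1}" using R by auto
    then show "RepC s ` ?E s
        \<in> {{RepF}, {RepU}} \<union> {RepC s ` E | s E. E \<in> sets borel \<and> E \<subseteq> {0..1}}"
      by blast
  qed
  moreover have "X \<inter> {r} \<in> sets report_space" if "r \<in> {RepF, RepU}" for r
    using that report_gen_sets by (cases "r \<in> X") auto
  ultimately have "?Y \<in> sets report_space"
    by (intro sets.Un) auto
  with eq show "X \<in> sets report_space"
    by (rule ssubst)
qed

lemma measurable_report_eq [measurable]:
  "(\<lambda>r. r = RepF) \<in> report_space \<rightarrow>\<^sub>M count_space UNIV"
  "(\<lambda>r. r = RepU) \<in> report_space \<rightarrow>\<^sub>M count_space UNIV"
  unfolding pred_def[symmetric] by (auto simp: pred_def sets_report_space)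

lemma measurable_treated_signal [measurable]:
  "treated_signal \<in> report_space \<rightarrow>\<^sub>M count_space UNIV"
proof (rule measurableI)
  fix A :: "signal set"
  have "{d. 0 \<le> d \<and> d \<le> (1::real) \<and> s \<in> A \<and> RepC s d \<in> reports} = (if s \<in> A then {0..1} else {})" for s
    by (auto simp: reports_def)
  then show "treated_signal -` A \<inter> space report_space \<in> sets report_space"
    by (simp add: sets_report_space)
qed simp

lemma measurable_treated_pred [measurable]: "treated_pred \<in> borel_measurable report_space"
proof (rule measurableI)
  fix A :: "real set" assume A: "A \<in> sets borel"
  have "{d. 0 \<le> d \<and> d \<le> (1::real) \<and> d \<in> A \<and> RepC s d \<in> reports} = A \<inter> {0..1}" for s
    by (auto simp: reports_def)
  then show "treated_pred -` A \<inter> space report_space \<in> sets report_space"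
    using A by (simp add: sets_report_space)
qed simp

lemma sorted_nth_less_iff:
  fixes xs :: "real list"
  assumes "sorted xs" "k < length xs"
  shows "xs ! k < a \<longleftrightarrow> k < length (filter (\<lambda>x. x < a) xs)"
  using assms
proof (induction xs arbitrary: k)
  case (Cons x xs)
  show ?case
  proof (cases k)
    case 0
    have "filter (\<lambda>y. y < a) xs = []" if "\<not> x < a"
      using Cons.prems that by (auto simp: filter_empty_conv)
    then show ?thesis using 0 by auto
  next
    case (Suc j)
    have "filter (\<lambda>y. y < a) xs = []" if "\<not> x < a"
      using Cons.prems that by (auto simp: filter_empty_conv)
    moreover have "xs ! j < a \<longleftrightarrow> j < length (filter (\<lambda>x. x < a) xs)"
      using Cons Suc by auto
    ultimately show ?thesis using Suc by auto
  qed
qed simp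

lemma median_pred_less_iff:
  assumes "odd T"
  shows "median_pred T r < a \<longleftrightarrow> T div 2 < card {t \<in> {..<T}. treated_pred (r t) < a}"
proof -
  let ?xs = "map (\<lambda>t. treated_pred (r t)) [0..<T]"
  have "length (filter (\<lambda>x. x < a) (sort ?xs)) = length (filter (\<lambda>x. x < a) ?xs)"
    by (simp flip: size_mset add: mset_filter)
  also have "\<dots> = length (filter (\<lambda>t. treated_pred (r t) < a) [0..<T])"
    by (simp add: filter_map o_def)
  also have "\<dots> = card (set (filter (\<lambda>t. treated_pred (r t) < a) [0..<T]))"
    by (rule distinct_card[symmetric]) simp
  also have "set (filter (\<lambda>t. treated_pred (r t) < a) [0..<T]) = {t \<in> {..<T}. treated_pred (r t) < a}"
    by auto
  finally show ?thesis
    unfolding median_pred_def using assms sorted_nth_less_iff[of "sort ?xs" "T div 2" a]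
    by (simp add: odd_pos)
qed

lemma accept_event_measurable:
  assumes "odd T" "is_profile T \<Sigma>"
  shows "{r \<in> space (\<Pi>\<^sub>M t\<in>{..<T}. \<Sigma> t (s t)). outcome T r = Accept}
           \<in> sets (\<Pi>\<^sub>M t\<in>{..<T}. \<Sigma> t (s t))"
proof -
  have "sets (\<Sigma> t (s t)) = sets report_space" if "t \<in> {..<T}" for t
    using assms(2) that by (auto simp: is_profile_def space_prob_algebra)
  then have sets: "sets (\<Pi>\<^sub>M t\<in>{..<T}. \<Sigma> t (s t)) = sets (\<Pi>\<^sub>M t\<in>{..<T}. report_space)"
    by (intro sets_PiM_cong) auto
  let ?M = "\<Pi>\<^sub>M t\<in>{..<T}. report_space"
  have card_meas: "(\<lambda>r. card {t \<in> {..<T}. Q t r}) \<in> ?M \<rightarrow>\<^sub>M count_space UNIV"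
    if "\<And>t. t < T \<Longrightarrow> (Measurable.pred ?M (Q t))" for Q
  proof (rule measurable_card)
    fix t
    show "{r \<in> space ?M. t \<in> {t \<in> {..<T}. Q t r}} \<in> sets ?M"
      using that[of t] by (cases "t < T") (auto simp: pred_def)
  qed
  have comp: "t < T \<Longrightarrow> (\<lambda>r. r t) \<in> ?M \<rightarrow>\<^sub>M report_space" for t
    by (rule measurable_component_singleton) simp
  have [measurable]: "(\<lambda>r. card {t \<in> {..<T}. r t = RepF}) \<in> ?M \<rightarrow>\<^sub>M count_space UNIV"
    "(\<lambda>r. card {t \<in> {..<T}. r t = RepU}) \<in> ?M \<rightarrow>\<^sub>M count_space UNIV"
    by (intro card_meas measurable_compose[OF comp] measurable_report_eq; simp)+
  have [measurable]: "(\<lambda>r. card {t \<in> {..<T}. treated_signal (r t) = SigH}) \<in> ?M \<rightarrow>\<^sub>M count_space UNIV"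
    (is "?K \<in> _")
    by (intro card_meas measurable_compose[OF comp, where g = "\<lambda>x. treated_signal x = SigH"])
       measurable
  have [measurable]: "(\<lambda>r. card {t \<in> {..<T}. treated_pred (r t) < real (?K r) / real T})
      \<in> ?M \<rightarrow>\<^sub>M count_space UNIV"
  proof (intro card_meas)
    fix t assume "t < T"
    note [measurable] = comp[OF this]
    show "Measurable.pred ?M (\<lambda>r. treated_pred (r t) < real (?K r) / real T)" by measurable
  qed
  have "outcome T r = Accept \<longleftrightarrow>
      real (card {t \<in> {..<T}. r t = RepF}) > real T / 2 \<or>
      \<not> real (card {t \<in> {..<T}. r t = RepU}) > real T / 2 \<and>
      T div 2 < card {t \<in> {..<T}. treated_pred (r t) < real (?K r) / real T}" for r
    by (simp add: outcome_def median_pred_less_iff[OF assms(1)])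
  then have "{r \<in> space ?M. outcome T r = Accept} \<in> sets ?M"
    by simp
  then show ?thesis using sets sets_eq_imp_space_eq[OF sets] by simp
qed

end

theory Submission
  imports Defs
begin

text \<open>Write \<open>x\<close> and \<open>y\<close> for the prior-weighted changes of the acceptance probability in \<open>H\<close> and \<open>L\<close>
  caused by a deviation of \<open>D\<close>. If \<open>F\<close> or \<open>U\<close> has a majority, the truthful outcome is constant and the
  best one for that type, so a deviation harmless to its members changes nothing. Otherwise, by
  Hoeffding's inequality, the truthful outcome is wrong with probability at most
  \<open>\<delta> = exp (- 2 c\<^sup>2 \<alpha>\<^sub>C T)\<close> in each world, hence \<open>x \<le> \<delta>\<close> and \<open>- \<delta> \<le> y\<close>.
  A type-\<open>C\<close> member of \<open>D\<close> who does not lose forces \<open>\<bar>x\<bar>, \<bar>y\<bar> \<le> B \<delta>\<close>.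
  If \<open>D\<close> contains both an \<open>F\<close> and a \<open>U\<close> agent, then since both types value acceptance more in \<open>H\<close>
  than in \<open>L\<close>, they can agree only on \<open>x \<ge> 0 \<ge> y\<close>, so again \<open>\<bar>x\<bar>, \<bar>y\<bar> \<le> \<delta>\<close>.
  If \<open>D\<close> consists of one of these types only, truthful reporting is already the most extreme report,
  and monotonicity of the mechanism excludes any gain.\<close>

section \<open>Types, two-point distributions and posterior means\<close>

lemma agent_type_iff:
  assumes "admissible B u"
  shows "agent_type u = \<tau> \<longleftrightarrow> has_type u \<tau>"
  unfolding agent_type_def using has_type_ex1[OF assms] by (metis (mono_tags, lifting) theI')

lemma pmf_SigL: "pmf p SigL = 1 - pmf p SigH"
proof -
  have "set_pmf p \<subseteq> {SigL, SigH}"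
    by (metis (full_types) insertCI subsetI signal.exhaust)
  then have "(\<Sum>m\<in>{SigL, SigH}. pmf p m) = 1"
    by (intro sum_pmf_eq_1) simp_all
  then show ?thesis by simp
qed

lemma pmf_WH: "pmf p WH = 1 - pmf p WL"
proof -
  have "set_pmf p \<subseteq> {WL, WH}"
    by (metis (full_types) insertCI subsetI world.exhaust)
  then have "(\<Sum>m\<in>{WL, WH}. pmf p m) = 1"
    by (intro sum_pmf_eq_1) simp_all
  then show ?thesis by simp
qed

text \<open>\<open>a\<close> and \<open>b\<close> are the chances of \<open>h\<close> in
  \<open>L\<close> and \<open>H\<close>. The fractions are posterior means of this chance after
  \<open>h\<close> and after \<open>l\<close>: as weighted averages they stay between
  \<open>a\<close> and \<open>b\<close>, and nonnegativity of the variance of this chance puts the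
  prior mean between them.\<close>

lemma posterior_order:
  fixes p q a b :: real
  assumes "p + q = 1" "0 < p" "0 < q" "0 \<le> a" "a < b" "b \<le> 1"
  shows "(p * a * a + q * b * b) / (p * a + q * b) \<le> b"
    and "p * a + q * b \<le> (p * a * a + q * b * b) / (p * a + q * b)"
    and "(p * (1 - a) * a + q * (1 - b) * b) / (p * (1 - a) + q * (1 - b)) \<le> p * a + q * b"
    and "a \<le> (p * (1 - a) * a + q * (1 - b) * b) / (p * (1 - a) + q * (1 - b))"
proof -
  have z: "p * a + q * b > 0" "p * (1 - a) + q * (1 - b) > 0"
    using assms by (simp_all add: add_nonneg_pos add_pos_nonneg)
  have q: "q = 1 - p" using assms by simp
  have "0 \<le> p * q * (b - a)\<^sup>2" using assms by simp
  also have "p * q * (b - a)\<^sup>2 = (p * a * a + q * b * b) - (p * a + q * b) * (p * a + q * b)"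
    unfolding q by (simp add: algebra_simps power2_eq_square)
  finally have var: "(p * a + q * b) * (p * a + q * b) \<le> p * a * a + q * b * b" by simp
  show "p * a + q * b \<le> (p * a * a + q * b * b) / (p * a + q * b)"
    using var z by (simp add: pos_le_divide_eq)
  have "(p * a + q * b) * (p * (1 - a) + q * (1 - b))
      = (p * a + q * b) - (p * a + q * b) * (p * a + q * b)"
    unfolding q by (simp add: algebra_simps)
  also have "\<dots> \<ge> (p * a + q * b) - (p * a * a + q * b * b)" using var by simp
  finally have "p * (1 - a) * a + q * (1 - b) * b
      \<le> (p * a + q * b) * (p * (1 - a) + q * (1 - b))"
    by (simp add: algebra_simps)
  then show "(p * (1 - a) * a + q * (1 - b) * b) / (p * (1 - a) + q * (1 - b)) \<le> p * a + q * b"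
    using z by (simp add: pos_divide_le_eq)
  have "0 \<le> p * a * (b - a)" using assms by simp
  then show "(p * a * a + q * b * b) / (p * a + q * b) \<le> b"
    using z by (simp add: pos_divide_le_eq algebra_simps)
  have "0 \<le> q * (1 - b) * (b - a)" using assms by simp
  then show "a \<le> (p * (1 - a) * a + q * (1 - b) * b) / (p * (1 - a) + q * (1 - b))"
    using z by (simp add: pos_le_divide_eq algebra_simps)
qed

section \<open>Monotonicity of the mechanism in the reports\<close>

lemma treated_pred_range:
  "r \<in> reports \<Longrightarrow> 0 \<le> treated_pred r" "r \<in> reports \<Longrightarrow> treated_pred r \<le> 1"
  by (auto simp: reports_def)

text \<open>Counting replaces the median: with \<open>T\<close> odd it is below the share iff more
  than \<open>T div 2\<close> predictions are.\<close>

lemma outcome_Accept_iff: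
  assumes "odd T"
  shows "outcome T r = Accept \<longleftrightarrow>
    real (card {t \<in> {..<T}. r t = RepF}) > real T / 2 \<or>
    \<not> real (card {t \<in> {..<T}. r t = RepU}) > real T / 2 \<and>
    T div 2 < card {t \<in> {..<T}. treated_pred (r t)
                      < real (card {t \<in> {..<T}. treated_signal (r t) = SigH}) / real T}"
  by (simp add: outcome_def median_pred_less_iff[OF assms])

lemma outcome_Reject_iff: "outcome T r = Reject \<longleftrightarrow> outcome T r \<noteq> Accept"
  by (cases "outcome T r") auto

text \<open>More \<open>RepF\<close>, fewer \<open>RepU\<close>, a larger share of
  \<open>SigH\<close> and lower predictions all favour acceptance; a prediction below the old share
  stays below the new one. Among legal reports \<open>RepF\<close> is the top of this order and
  \<open>RepU\<close> the bottom.\<close>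

lemma outcome_mono:
  assumes "odd T"
    and F: "\<And>t. t < T \<Longrightarrow> r t = RepF \<Longrightarrow> r' t = RepF"
    and U: "\<And>t. t < T \<Longrightarrow> r' t = RepU \<Longrightarrow> r t = RepU"
    and S: "\<And>t. t < T \<Longrightarrow> treated_signal (r t) = SigH \<Longrightarrow> treated_signal (r' t) = SigH"
    and P: "\<And>t. t < T \<Longrightarrow> treated_pred (r' t) \<le> treated_pred (r t)"
    and acc: "outcome T r = Accept"
  shows "outcome T r' = Accept"
proof -
  have cF: "card {t \<in> {..<T}. r t = RepF} \<le> card {t \<in> {..<T}. r' t = RepF}"
    using F by (intro card_mono) auto
  have cU: "card {t \<in> {..<T}. r' t = RepU} \<le> card {t \<in> {..<T}. r t = RepU}"
    using U by (intro card_mono) auto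
  let ?K = "\<lambda>r. real (card {t \<in> {..<T}. treated_signal (r t) = SigH}) / real T"
  have "card {t \<in> {..<T}. treated_signal (r t) = SigH}
      \<le> card {t \<in> {..<T}. treated_signal (r' t) = SigH}"
    using S by (intro card_mono) auto
  then have "?K r \<le> ?K r'" by (simp add: divide_right_mono)
  then have "card {t \<in> {..<T}. treated_pred (r t) < ?K r}
      \<le> card {t \<in> {..<T}. treated_pred (r' t) < ?K r'}"
    using P by (intro card_mono) force+
  with cF cU acc show ?thesis
    unfolding outcome_Accept_iff[OF \<open>odd T\<close>] by auto
qed

lemma outcome_cong:
  assumes "odd T" and eq: "\<And>t. t < T \<Longrightarrow> r t = r' t"
  shows "outcome T r = outcome T r'"
proof (cases "outcome T r = Accept")
  case True
  then show ?thesis using outcome_mono[OF \<open>odd T\<close>, of r r'] eq by simp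
next
  case False
  then have "outcome T r' \<noteq> Accept" using outcome_mono[OF \<open>odd T\<close>, of r' r] eq by fastforce
  with False show ?thesis by (simp flip: outcome_Reject_iff)
qed

section \<open>Concentration of the number of high signals\<close>

text \<open>Hoeffding's inequality for indicators of \<open>SigH\<close>. Only agents in
  \<open>J\<close> are counted, later the contingent ones among all agents \<open>I\<close>.\<close>

lemma signal_count_tail:
  fixes J :: "nat set" and p :: "signal pmf"
  assumes "finite I" "J \<subseteq> I" "J \<noteq> {}" "g \<ge> 0"
  defines "M \<equiv> measure_pmf (Pi_pmf I undefined (\<lambda>_. p))"
  shows "measure M {s. real (card {t \<in> J. s t = SigH}) \<ge> real (card J) * (pmf p SigH + g)}
           \<le> exp (- 2 * g\<^sup>2 * real (card J))" (is ?upper)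
    and "measure M {s. real (card {t \<in> J. s t = SigH}) \<le> real (card J) * (pmf p SigH - g)}
           \<le> exp (- 2 * g\<^sup>2 * real (card J))" (is ?lower)
proof -
  let ?X = "\<lambda>t s. indicator {SigH} (s t) :: real"
  have finJ: "finite J" using assms finite_subset by blast
  have E: "measure_pmf.expectation (Pi_pmf I undefined (\<lambda>_. p)) (?X t) = pmf p SigH"
    if "t \<in> J" for t
  proof -
    have "measure_pmf.expectation (Pi_pmf I undefined (\<lambda>_. p)) (?X t)
        = measure_pmf.expectation (map_pmf (\<lambda>s. s t) (Pi_pmf I undefined (\<lambda>_. p)))
            (indicator {SigH})"
      by (subst integral_map_pmf) (rule refl)
    also have "map_pmf (\<lambda>s. s t) (Pi_pmf I undefined (\<lambda>_. p)) = p"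
      using assms that by (subst Pi_pmf_component) auto
    finally show ?thesis by (simp add: measure_pmf_single)
  qed
  interpret H: Hoeffding_ineq "measure_pmf (Pi_pmf I undefined (\<lambda>_. p))" J ?X
    "\<lambda>_. 0" "\<lambda>_. 1" "real (card J) * pmf p SigH"
  proof unfold_locales
    have "prob_space.indep_vars (measure_pmf (Pi_pmf I undefined (\<lambda>_. p)))
        (\<lambda>_. count_space UNIV) (\<lambda>x f. f x) J"
      using indep_vars_Pi_pmf[OF \<open>finite I\<close>] \<open>J \<subseteq> I\<close>
      by (rule prob_space.indep_vars_subset[OF measure_pmf.prob_space_axioms])
    then show "prob_space.indep_vars (measure_pmf (Pi_pmf I undefined (\<lambda>_. p)))
        (\<lambda>_. borel) ?X J"
      by (rule prob_space.indep_vars_compose2[OF measure_pmf.prob_space_axioms]) auto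
  qed (use finJ E in auto)
  have cJ: "card J > 0" using finJ \<open>J \<noteq> {}\<close> by (simp add: card_gt_0_iff)
  have count: "(\<Sum>t\<in>J. ?X t s) = real (card {t \<in> J. s t = SigH})" for s
    using finJ by (simp add: indicator_def sum.If_cases Int_def)
  \<comment> \<open>Each range has length 1, so the denominator is \<open>card J\<close> and one
    factor \<open>card J\<close> survives in the exponent.\<close>
  have ex: "exp (- 2 * (real (card J) * g)\<^sup>2 / (\<Sum>t\<in>J. (1 - 0)\<^sup>2)) = exp (- 2 * g\<^sup>2 * real (card J))"
    using cJ by (simp add: power2_eq_square field_simps)
  show ?upper
    using H.Hoeffding_ineq_ge[of "real (card J) * g"] cJ \<open>g \<ge> 0\<close>
    unfolding ex count by (simp add: M_def distrib_left)
  show ?lower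
    using H.Hoeffding_ineq_le[of "real (card J) * g"] cJ \<open>g \<ge> 0\<close>
    unfolding ex count by (simp add: M_def right_diff_distrib)
qed

section \<open>Linear inequalities for the shifts of acceptance\<close>

text \<open>\<open>a\<close>, \<open>b\<close> are a friendly agent's stakes in \<open>H\<close> and
  \<open>L\<close>; \<open>a'\<close>, \<open>b'\<close> are an unfriendly agent's, negated. If
  \<open>x < 0\<close>, then \<open>b < a\<close> turns the first sum into \<open>x + y > 0\<close>,
  and \<open>a' < b'\<close> makes the second sum positive. Once \<open>0 \<le> x\<close>, the
  second sum forces \<open>y \<le> 0\<close>.\<close>

lemma opposed_interests:
  fixes a b a' b' x y :: real
  assumes "b < a" "0 < b" "a' < b'" "0 < a'"
    and "0 \<le> a * x + b * y" "a' * x + b' * y \<le> 0"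
  shows "0 \<le> x" "y \<le> 0"
proof -
  show x: "0 \<le> x"
  proof (rule ccontr)
    assume "\<not> 0 \<le> x"
    then have x: "x < 0" by simp
    have "b * x > a * x" using x \<open>b < a\<close> by (simp add: mult_less_cancel_right)
    then have "b * (x + y) > 0" using assms(5) by (simp add: distrib_left)
    then have "x + y > 0" using \<open>0 < b\<close> by (simp add: zero_less_mult_iff)
    then have "b' * (x + y) > 0" using assms by simp
    moreover have "b' * x < a' * x" using x \<open>a' < b'\<close> by (simp add: mult_less_cancel_right)
    ultimately show False using assms(6) by (simp add: distrib_left)
  qed
  have "0 \<le> a' * x" using x \<open>0 < a'\<close> by simp
  then have "b' * y \<le> 0" using assms(6) by simp
  then show "y \<le> 0" using assms by (simp add: mult_le_0_iff)
qed

text \<open>A contingent agent with stakes \<open>a\<close> in \<open>H\<close> and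
  \<open>- b\<close> in \<open>L\<close> does not lose iff \<open>b * y \<le> a * x\<close>. So
  \<open>x < 0\<close> gives \<open>- k * d \<le> b * y \<le> a * x \<le> x\<close>, and
  \<open>y > 0\<close> gives \<open>y \<le> b * y \<le> a * x \<le> k * d\<close>.\<close>

lemma contingent_shift_bound:
  fixes a b x y d k :: real
  assumes "1 \<le> a" "a \<le> k" "1 \<le> b" "b \<le> k"
    and "b * y \<le> a * x" "x \<le> d" "- d \<le> y" "0 \<le> d"
  shows "\<bar>x\<bar> \<le> k * d" "\<bar>y\<bar> \<le> k * d"
proof -
  have kd: "a * d \<le> k * d" "b * d \<le> k * d" "d \<le> k * d"
    using assms by (auto intro: mult_right_mono simp: mult_le_cancel_right1)
  have "b * - d \<le> b * y" using assms by (intro mult_left_mono) auto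
  moreover have "a * x \<le> x" if "x < 0" using that assms by (simp add: mult_le_cancel_right2)
  ultimately show "\<bar>x\<bar> \<le> k * d" using assms kd by fastforce
  have "a * x \<le> a * d" using assms by (intro mult_left_mono) auto
  moreover have "0 < y \<Longrightarrow> y \<le> b * y" using assms by (simp add: mult_le_cancel_right1)
  ultimately have "0 < y \<Longrightarrow> y \<le> k * d" using assms(5) kd(1) by linarith
  then show "\<bar>y\<bar> \<le> k * d" using assms kd(3) by (cases "0 < y") (simp_all add: abs_if)
qed

section \<open>The voting model and its agents by type\<close>

locale wisdom_voting =
  fixes T B :: nat
    and pW :: "world pmf"
    and pS :: "world \<Rightarrow> signal pmf"
    and v :: "nat \<Rightarrow> world \<Rightarrow> alternative \<Rightarrow> nat"
  assumes odd_T: "odd T"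
    and prior_pos: "pmf pW WL > 0" "pmf pW WH > 0"
    and informative: "pmf (pS WH) SigH > pmf (pS WL) SigH"
    and admissible: "\<And>t. t < T \<Longrightarrow> admissible B (v t)"
begin

definition agents :: "atype \<Rightarrow> nat set" where
  "agents \<tau> = {t \<in> {..<T}. agent_type (v t) = \<tau>}"

definition truth :: "(nat \<Rightarrow> signal) \<Rightarrow> nat \<Rightarrow> report" where
  "truth s t = truthful_report T pW pS v t (s t)"

text \<open>The integrand of \<open>accept_prob\<close>, so that profiles can be compared one signal
  vector at a time.\<close>

definition accept_meas :: "(nat \<Rightarrow> strategy) \<Rightarrow> (nat \<Rightarrow> signal) \<Rightarrow> real" where
  "accept_meas \<Sigma> s = measure (\<Pi>\<^sub>M t\<in>{..<T}. \<Sigma> t (s t))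
     {r \<in> space (\<Pi>\<^sub>M t\<in>{..<T}. \<Sigma> t (s t)). outcome T r = Accept}"

text \<open>Only contingent agents' signals affect truthful reports, so the exponent counts these
  agents; their number is \<open>\<alpha>\<^sub>C * real T\<close>.\<close>

definition delta :: real where
  "delta = exp (- 2 * gap_const pW pS ^ 2 * real (card (agents Contingent)))"

abbreviation "TH \<equiv> post_pred pW pS SigH"
abbreviation "signals n \<equiv> Pi_pmf {..<T} undefined (\<lambda>_. pS n)"
abbreviation "accept_shift n \<Sigma> \<equiv> pmf pW n *
  (accept_prob T pS \<Sigma> n - accept_prob T pS (truthful T pW pS v) n)"

lemma T_pos: "T > 0"
  using odd_T by (rule odd_pos)

lemma finite_agents: "finite (agents \<tau>)"
  by (simp add: agents_def)

lemma agents_less: "t \<in> agents \<tau> \<Longrightarrow> t < T"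
  by (simp add: agents_def)

lemma agents_type: "t \<in> agents \<tau> \<Longrightarrow> has_type (v t) \<tau>"
  using agent_type_iff[OF admissible] by (auto simp: agents_def)

lemma agents_cases:
  assumes "t < T"
  obtains "t \<in> agents Friendly" | "t \<in> agents Unfriendly" | "t \<in> agents Contingent"
  using assms by (cases "agent_type (v t)") (auto simp: agents_def)

lemma agents_disjoint: "\<sigma> \<noteq> \<tau> \<Longrightarrow> agents \<sigma> \<inter> agents \<tau> = {}"
  by (auto simp: agents_def)

lemma card_agents:
  "card (agents Friendly) + card (agents Unfriendly) + card (agents Contingent) = T"
proof -
  have "{..<T} = agents Friendly \<union> agents Unfriendly \<union> agents Contingent"
    by (auto elim: agents_cases simp: agents_less)
  then have "T = card (agents Friendly \<union> agents Unfriendly \<union> agents Contingent)"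
    by (metis card_lessThan)
  also have "\<dots> = card (agents Friendly) + card (agents Unfriendly) + card (agents Contingent)"
    by (subst card_Un_disjoint; simp add: finite_agents agents_disjoint Int_Un_distrib2)+
  finally show ?thesis by simp
qed

lemma type_frac_agents: "type_frac T v \<tau> = real (card (agents \<tau>)) / real T"
  by (simp add: type_frac_def agents_def)

section \<open>Truthful predictions and their distance from the signal frequencies\<close>

lemma pmf_SigH_pos: "pmf (pS WH) SigH > 0"
  using informative pmf_nonneg[of "pS WL" SigH] by linarith

lemma post_pred_SigH:
  shows "TH SigH = (pmf pW WL * pmf (pS WL) SigH * pmf (pS WL) SigH
           + pmf pW WH * pmf (pS WH) SigH * pmf (pS WH) SigH)
         / (pmf pW WL * pmf (pS WL) SigH + pmf pW WH * pmf (pS WH) SigH)"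
    and "TH SigL = (pmf pW WL * (1 - pmf (pS WL) SigH) * pmf (pS WL) SigH
           + pmf pW WH * (1 - pmf (pS WH) SigH) * pmf (pS WH) SigH)
         / (pmf pW WL * (1 - pmf (pS WL) SigH) + pmf pW WH * (1 - pmf (pS WH) SigH))"
  by (simp_all add: post_pred_def Let_def pmf_SigL add_divide_distrib)

lemma evidence_pos: "pmf pW WL * pmf (pS WL) m + pmf pW WH * pmf (pS WH) m > 0"
proof (cases m)
  case SigL
  have "pmf (pS WL) SigL > 0"
    using informative pmf_le_1[of "pS WH" SigH] by (simp add: pmf_SigL)
  then show ?thesis using SigL prior_pos by (simp add: add_pos_nonneg)
next
  case SigH
  then show ?thesis using pmf_SigH_pos prior_pos by (simp add: add_nonneg_pos)
qed

lemma post_pred_SigL: "post_pred pW pS SigL m = 1 - TH m"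
proof -
  let ?z = "pmf pW WL * pmf (pS WL) m + pmf pW WH * pmf (pS WH) m"
  have "pmf pW WL * pmf (pS WL) m / ?z + pmf pW WH * pmf (pS WH) m / ?z = 1"
    using evidence_pos[of m] by (simp flip: add_divide_distrib)
  then show ?thesis
    unfolding post_pred_def Let_def pmf_SigL[of "pS WL"] pmf_SigL[of "pS WH"]
    by (simp add: right_diff_distrib)
qed

text \<open>An instance of \<open>posterior_order\<close>. In both worlds the predictions lie on the
  side of the \<open>h\<close> frequency from which the vote comes out right.\<close>

lemma TH_order:
  "pmf (pS WL) SigH \<le> TH SigL" "TH SigL \<le> TH SigH" "TH SigH \<le> pmf (pS WH) SigH"
proof -
  have "pmf pW WL + pmf pW WH = 1" by (simp add: pmf_WH)
  note order = posterior_order[OF this prior_pos pmf_nonneg informative pmf_le_1]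
  show "pmf (pS WL) SigH \<le> TH SigL" "TH SigL \<le> TH SigH" "TH SigH \<le> pmf (pS WH) SigH"
    unfolding post_pred_SigH using order by linarith+
qed

lemma TH_range: "0 \<le> TH m" "TH m \<le> 1"
proof -
  from TH_order pmf_nonneg[of "pS WL" SigH] pmf_le_1[of "pS WH" SigH]
  have "0 \<le> TH SigL" "0 \<le> TH SigH" "TH SigL \<le> 1" "TH SigH \<le> 1" by linarith+
  then show "0 \<le> TH m" "TH m \<le> 1" by (metis signal.exhaust)+
qed

text \<open>A third of a minimum of nonnegative gaps is at most each gap. The two chosen gaps
  measure how far, per contingent agent, the \<open>h\<close> count must miss its mean for the
  truthful vote to err in \<open>H\<close> and in \<open>L\<close>.\<close>

lemma gap_const_bounds:
  shows "gap_const pW pS \<ge> 0"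
    and "gap_const pW pS \<le> pmf (pS WH) SigH - TH SigH"
    and "gap_const pW pS \<le> TH SigL - pmf (pS WL) SigH"
proof -
  let ?gaps = "{post_pred pW pS SigL SigH - pmf (pS WH) SigL,
    post_pred pW pS SigL SigL - post_pred pW pS SigL SigH,
    pmf (pS WL) SigL - post_pred pW pS SigL SigL, pmf (pS WH) SigH - TH SigH,
    TH SigH - TH SigL, TH SigL - pmf (pS WL) SigH}"
  have nonneg: "0 \<le> g" if "g \<in> ?gaps" for g
    using that TH_order by (auto simp: post_pred_SigL pmf_SigL)
  have gap: "gap_const pW pS = Min ?gaps / 3"
    by (simp only: gap_const_def Let_def)
  have "0 \<le> Min ?gaps"
    using nonneg by (intro Min.boundedI) blast+
  then show "gap_const pW pS \<ge> 0" unfolding gap by simp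
  have "gap_const pW pS \<le> g" if "g \<in> ?gaps" for g
  proof -
    have "Min ?gaps \<le> g" using that by (intro Min_le) blast+
    then show ?thesis unfolding gap using \<open>0 \<le> Min ?gaps\<close> by linarith
  qed
  then show "gap_const pW pS \<le> pmf (pS WH) SigH - TH SigH"
    "gap_const pW pS \<le> TH SigL - pmf (pS WL) SigH"
    by blast+
qed

section \<open>Truthful reports and acceptance given the signals\<close>

lemma truth_Friendly: "t \<in> agents Friendly \<Longrightarrow> truth s t = RepF"
  and truth_Unfriendly: "t \<in> agents Unfriendly \<Longrightarrow> truth s t = RepU"
  and truth_Contingent: "t \<in> agents Contingent \<Longrightarrow>
    truth s t = RepC (s t) (type_frac T v Friendly + type_frac T v Contingent * TH (s t))"
  by (simp_all add: agents_def truth_def truthful_report_def)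

lemma prediction_range:
  "type_frac T v Friendly + type_frac T v Contingent * TH m \<in> {0..1}"
proof -
  have "type_frac T v Contingent * TH m \<le> type_frac T v Contingent * 1"
    using TH_range by (intro mult_left_mono) (auto simp: type_frac_agents)
  moreover have "real (card (agents Friendly)) + real (card (agents Contingent)) \<le> real T"
    using card_agents by linarith
  then have "type_frac T v Friendly + type_frac T v Contingent \<le> 1"
    using T_pos by (simp add: type_frac_agents flip: add_divide_distrib)
  ultimately show ?thesis
    using TH_range by (auto simp: type_frac_agents)
qed

lemma truth_in_reports: "t < T \<Longrightarrow> truth s t \<in> reports"
  using prediction_range
  by (elim agents_cases)
     (auto simp: truth_Friendly truth_Unfriendly truth_Contingent reports_def)

lemma truthful_eq: "truthful T pW pS v t (s t) = return report_space (truth s t)"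
  by (simp add: truthful_def truth_def)

lemma is_profile_truthful: "is_profile T (truthful T pW pS v)"
  unfolding is_profile_def space_prob_algebra mem_Collect_eq
proof (intro allI impI conjI)
  fix t m assume "t < T"
  then show "prob_space (truthful T pW pS v t m)"
    using truthful_eq[of t "\<lambda>_. m"] truth_in_reports by (simp add: prob_space_return)
  show "sets (truthful T pW pS v t m) = sets report_space"
    by (simp add: truthful_def)
qed

lemma profile_prob_space:
  "is_profile T \<Sigma> \<Longrightarrow> t < T \<Longrightarrow> prob_space (\<Sigma> t m)"
  by (auto simp: is_profile_def space_prob_algebra)

lemma profile_PiM_prob_space:
  "is_profile T \<Sigma> \<Longrightarrow> prob_space (\<Pi>\<^sub>M t\<in>{..<T}. \<Sigma> t (s t))"
  by (intro prob_space_PiM profile_prob_space) auto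

lemma singleton_report_sets:
  assumes "x \<in> reports"
  shows "{x} \<in> sets report_space"
proof -
  have "{d \<in> {0..1}. RepC m d = x} \<in> sets borel" for m
  proof (cases x)
    case (RepC m' d)
    then have "{d \<in> {0..1}. RepC m d = x} = (if m = m' \<and> d \<in> {0..1} then {d} else {})" by auto
    then show ?thesis by simp
  qed auto
  then show ?thesis using assms by (simp add: sets_report_space)
qed

text \<open>Outside \<open>D\<close> each strategy is a point mass, and finitely many null sets can
  be discarded at once. Legality of the reports holds on the whole product space.\<close>

lemma AE_follow_truth:
  assumes \<Sigma>: "is_profile T \<Sigma>" and eq: "\<forall>t \<in> {..<T} - D. \<Sigma> t = truthful T pW pS v t"
  shows "AE r in (\<Pi>\<^sub>M t\<in>{..<T}. \<Sigma> t (s t)).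
    (\<forall>t<T. r t \<in> reports) \<and> (\<forall>t\<in>{..<T} - D. r t = truth s t)"
proof -
  have "AE r in (\<Pi>\<^sub>M t\<in>{..<T}. \<Sigma> t (s t)). r t = truth s t" if t: "t \<in> {..<T} - D" for t
  proof (rule AE_PiM_component)
    have "Measurable.pred report_space (\<lambda>r. r = truth s t)"
      using singleton_report_sets[OF truth_in_reports] t
      by (auto simp: pred_def Int_def truth_in_reports cong: conj_cong)
    moreover have S: "\<Sigma> t (s t) = return report_space (truth s t)"
      using t eq by (simp flip: truthful_eq)
    ultimately show "AE x in \<Sigma> t (s t). x = truth s t"
      unfolding S using t truth_in_reports by (subst AE_return) auto
  qed (use t profile_prob_space[OF \<Sigma>] in auto)
  then have "AE r in (\<Pi>\<^sub>M t\<in>{..<T}. \<Sigma> t (s t)). \<forall>t\<in>{..<T} - D. r t = truth s t"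
    by (simp add: eventually_ball_finite_distrib)
  moreover have "AE r in (\<Pi>\<^sub>M t\<in>{..<T}. \<Sigma> t (s t)). \<forall>t<T. r t \<in> reports"
  proof (rule AE_I2, safe)
    fix r t assume "r \<in> space (\<Pi>\<^sub>M t\<in>{..<T}. \<Sigma> t (s t))" "t < T"
    moreover from this have "space (\<Sigma> t (s t)) = reports"
      using \<Sigma> sets_eq_imp_space_eq[of "\<Sigma> t (s t)" report_space]
      by (auto simp: is_profile_def space_prob_algebra)
    ultimately show "r t \<in> reports" by (auto simp: space_PiM PiE_iff)
  qed
  ultimately show ?thesis by eventually_elim auto
qed

text \<open>Removes the deviators' randomness: if no legal reports of \<open>D\<close> can change
  the outcome, acceptance has probability 0 or 1. Later arguments about \<open>D\<close> can then
  work with fixed report vectors.\<close>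

lemma accept_meas_determined:
  assumes \<Sigma>: "is_profile T \<Sigma>" and eq: "\<forall>t \<in> {..<T} - D. \<Sigma> t = truthful T pW pS v t"
    and det: "\<And>r. \<forall>t<T. r t \<in> reports \<Longrightarrow> \<forall>t\<in>{..<T} - D. r t = truth s t \<Longrightarrow> outcome T r = a"
  shows "accept_meas \<Sigma> s = of_bool (a = Accept)"
proof -
  let ?M = "\<Pi>\<^sub>M t\<in>{..<T}. \<Sigma> t (s t)"
  interpret prob_space ?M using profile_PiM_prob_space[OF \<Sigma>] .
  have ae: "AE r in ?M. outcome T r = a"
    using AE_follow_truth[OF \<Sigma> eq, of s] by eventually_elim (use det in blast)
  note meas = accept_event_measurable[OF odd_T \<Sigma>, of s]
  show ?thesis
  proof (cases "a = Accept")
    case True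
    have "prob {r \<in> space ?M. outcome T r = Accept} = 1"
      using ae True by (subst prob_Collect_eq_1[OF meas]) auto
    then show ?thesis using True by (simp add: accept_meas_def)
  next
    case False
    have "prob {r \<in> space ?M. outcome T r = Accept} = 0"
      using ae False by (subst prob_Collect_eq_0[OF meas]) auto
    then show ?thesis using False by (simp add: accept_meas_def)
  qed
qed

lemma accept_meas_range: "0 \<le> accept_meas \<Sigma> s" "is_profile T \<Sigma> \<Longrightarrow> accept_meas \<Sigma> s \<le> 1"
  using prob_space.prob_le_1[OF profile_PiM_prob_space] by (auto simp: accept_meas_def)

lemma accept_meas_truthful:
  "accept_meas (truthful T pW pS v) s = of_bool (outcome T (truth s) = Accept)"
  by (rule accept_meas_determined[OF is_profile_truthful, where D = "{}"])
     (auto intro!: outcome_cong odd_T)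

lemma accept_prob_eq:
  "accept_prob T pS \<Sigma> n = measure_pmf.expectation (signals n) (accept_meas \<Sigma>)"
  by (simp add: accept_prob_def accept_meas_def[abs_def])

lemma integrable_accept_meas:
  "is_profile T \<Sigma> \<Longrightarrow> integrable (measure_pmf (signals n)) (accept_meas \<Sigma>)"
  by (rule measure_pmf.integrable_const_bound[of _ 1])
     (use accept_meas_range in auto)

lemma accept_prob_mono:
  assumes "is_profile T \<Sigma>" "is_profile T \<Sigma>'" "\<And>s. accept_meas \<Sigma> s \<le> accept_meas \<Sigma>' s"
  shows "accept_prob T pS \<Sigma> n \<le> accept_prob T pS \<Sigma>' n"
  unfolding accept_prob_eq using assms by (intro integral_mono integrable_accept_meas)

lemma accept_prob_range:
  assumes "is_profile T \<Sigma>"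
  shows "0 \<le> accept_prob T pS \<Sigma> n" "accept_prob T pS \<Sigma> n \<le> 1"
proof -
  show "0 \<le> accept_prob T pS \<Sigma> n"
    unfolding accept_prob_eq by (intro Bochner_Integration.integral_nonneg accept_meas_range)
  have "accept_prob T pS \<Sigma> n \<le> measure_pmf.expectation (signals n) (\<lambda>_. 1)"
    unfolding accept_prob_eq using assms
    by (intro integral_mono integrable_accept_meas accept_meas_range) auto
  then show "accept_prob T pS \<Sigma> n \<le> 1" by simp
qed

lemma accept_prob_const:
  assumes "\<And>s. accept_meas \<Sigma> s = k"
  shows "accept_prob T pS \<Sigma> n = k"
proof -
  have "accept_meas \<Sigma> = (\<lambda>_. k)" using assms by auto
  then show ?thesis by (simp add: accept_prob_eq)
qed

lemma accept_prob_truthful: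
  "accept_prob T pS (truthful T pW pS v) n
     = measure (measure_pmf (signals n)) {s. outcome T (truth s) = Accept}"
proof -
  have "accept_meas (truthful T pW pS v) = indicator {s. outcome T (truth s) = Accept}"
    by (auto simp: accept_meas_truthful indicator_def)
  then show ?thesis by (simp add: accept_prob_eq)
qed

section \<open>Coalitions of one type and majorities\<close>

text \<open>By \<open>outcome_mono\<close>, truthful \<open>RepF\<close> favours acceptance at least
  as much as any legal report, so a truthful rejection persists whatever \<open>D\<close>
  reports.\<close>

lemma friendly_deviation:
  assumes \<Sigma>: "is_profile T \<Sigma>" and eq: "\<forall>t \<in> {..<T} - D. \<Sigma> t = truthful T pW pS v t"
    and D: "D \<subseteq> agents Friendly"
  shows "accept_prob T pS \<Sigma> n \<le> accept_prob T pS (truthful T pW pS v) n"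
proof (rule accept_prob_mono[OF \<Sigma> is_profile_truthful])
  fix s
  show "accept_meas \<Sigma> s \<le> accept_meas (truthful T pW pS v) s"
  proof (cases "outcome T (truth s) = Accept")
    case True
    then show ?thesis using accept_meas_range(2)[OF \<Sigma>] by (simp add: accept_meas_truthful)
  next
    case False
    have "accept_meas \<Sigma> s = of_bool (Reject = Accept)"
    proof (rule accept_meas_determined[OF \<Sigma> eq])
      fix r assume r: "\<forall>t<T. r t \<in> reports" "\<forall>t\<in>{..<T} - D. r t = truth s t"
      have "outcome T r \<noteq> Accept"
      proof
        assume acc: "outcome T r = Accept"
        have "outcome T (truth s) = Accept"
        proof (rule outcome_mono[OF odd_T _ _ _ _ acc])
          fix t assume t: "t < T"
          have "treated_pred (r t) \<ge> 0"
            using treated_pred_range r t by blast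
          moreover have "truth s t = RepF" if "t \<in> D"
            using that D truth_Friendly by blast
          ultimately consider "r t = truth s t"
            | "truth s t = RepF" "treated_pred (r t) \<ge> 0"
            using r t by blast
          note dom = this
          show "r t = RepF \<Longrightarrow> truth s t = RepF" "truth s t = RepU \<Longrightarrow> r t = RepU"
            "treated_signal (r t) = SigH \<Longrightarrow> treated_signal (truth s t) = SigH"
            "treated_pred (truth s t) \<le> treated_pred (r t)"
            by (cases rule: dom; simp)+
        qed
        then show False using False by simp
      qed
      then show "outcome T r = Reject" by (simp add: outcome_Reject_iff)
    qed
    then show ?thesis using accept_meas_range(1) by simp
  qed
qed

text \<open>\<open>RepU\<close> is the bottom of the same order, so a truthful acceptance
  persists.\<close>

lemma unfriendly_deviation:
  assumes \<Sigma>: "is_profile T \<Sigma>" and eq: "\<forall>t \<in> {..<T} - D. \<Sigma> t = truthful T pW pS v t"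
    and D: "D \<subseteq> agents Unfriendly"
  shows "accept_prob T pS (truthful T pW pS v) n \<le> accept_prob T pS \<Sigma> n"
proof (rule accept_prob_mono[OF is_profile_truthful \<Sigma>])
  fix s
  show "accept_meas (truthful T pW pS v) s \<le> accept_meas \<Sigma> s"
  proof (cases "outcome T (truth s) = Accept")
    case False
    then show ?thesis using accept_meas_range(1) by (simp add: accept_meas_truthful)
  next
    case True
    have "accept_meas \<Sigma> s = of_bool (Accept = Accept)"
    proof (rule accept_meas_determined[OF \<Sigma> eq])
      fix r assume r: "\<forall>t<T. r t \<in> reports" "\<forall>t\<in>{..<T} - D. r t = truth s t"
      show "outcome T r = Accept"
      proof (rule outcome_mono[OF odd_T _ _ _ _ True])
        fix t assume t: "t < T"
        have "treated_pred (r t) \<le> 1"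
          using treated_pred_range r t by blast
        moreover have "truth s t = RepU" if "t \<in> D"
          using that D truth_Unfriendly by blast
        ultimately consider "r t = truth s t"
          | "truth s t = RepU" "treated_pred (r t) \<le> 1"
          using r t by blast
        note dom = this
        show "truth s t = RepF \<Longrightarrow> r t = RepF" "r t = RepU \<Longrightarrow> truth s t = RepU"
          "treated_signal (truth s t) = SigH \<Longrightarrow> treated_signal (r t) = SigH"
          "treated_pred (r t) \<le> treated_pred (truth s t)"
          by (cases rule: dom; simp)+
      qed
    qed
    then show ?thesis using accept_meas_range(2)[OF is_profile_truthful] by simp
  qed
qed

text \<open>The friendly agents' own reports settle the first test. Applied with
  \<open>D = {}\<close> to the truthful profile and then to coalitions without friendly
  members.\<close>

lemma friendly_majority:
  assumes \<Sigma>: "is_profile T \<Sigma>" and eq: "\<forall>t \<in> {..<T} - D. \<Sigma> t = truthful T pW pS v t"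
    and D: "D \<inter> agents Friendly = {}" and maj: "real (card (agents Friendly)) > real T / 2"
  shows "accept_prob T pS \<Sigma> n = 1"
proof (rule accept_prob_const)
  fix s
  have "accept_meas \<Sigma> s = of_bool (Accept = Accept)"
  proof (rule accept_meas_determined[OF \<Sigma> eq])
    fix r assume r: "\<forall>t\<in>{..<T} - D. r t = truth s t"
    have "card (agents Friendly) \<le> card {t \<in> {..<T}. r t = RepF}"
      using r D truth_Friendly by (intro card_mono) (force simp: agents_less)+
    then show "outcome T r = Accept" using maj by (simp add: outcome_def)
  qed
  then show "accept_meas \<Sigma> s = 1" by simp
qed

lemma unfriendly_majority:
  assumes \<Sigma>: "is_profile T \<Sigma>" and eq: "\<forall>t \<in> {..<T} - D. \<Sigma> t = truthful T pW pS v t"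
    and D: "D \<inter> agents Unfriendly = {}" and maj: "real (card (agents Unfriendly)) > real T / 2"
  shows "accept_prob T pS \<Sigma> n = 0"
proof (rule accept_prob_const)
  fix s
  have "accept_meas \<Sigma> s = of_bool (Reject = Accept)"
  proof (rule accept_meas_determined[OF \<Sigma> eq])
    fix r assume r: "\<forall>t\<in>{..<T} - D. r t = truth s t"
    have U: "card (agents Unfriendly) \<le> card {t \<in> {..<T}. r t = RepU}"
      using r D truth_Unfriendly by (intro card_mono) (force simp: agents_less)+
    \<comment> \<open>The test for \<open>RepF\<close> comes first, so a majority of
      \<open>RepF\<close> has to be excluded.\<close>
    have "card {t \<in> {..<T}. r t = RepU} + card {t \<in> {..<T}. r t = RepF}
        = card ({t \<in> {..<T}. r t = RepU} \<union> {t \<in> {..<T}. r t = RepF})"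
      by (subst card_Un_disjoint) auto
    also have "\<dots> \<le> card {..<T}" by (intro card_mono) auto
    finally have "card {t \<in> {..<T}. r t = RepU} + card {t \<in> {..<T}. r t = RepF} \<le> T" by simp
    then show "outcome T r = Reject" using maj U by (simp add: outcome_def)
  qed
  then show "accept_meas \<Sigma> s = 0" by simp
qed

section \<open>The truthful outcome when neither side has a majority\<close>

lemma truth_by_type:
  assumes "t < T"
  shows "truth s t = (case agent_type (v t) of Friendly \<Rightarrow> RepF | Unfriendly \<Rightarrow> RepU
    | Contingent \<Rightarrow>
        RepC (s t) (type_frac T v Friendly + type_frac T v Contingent * TH (s t)))"
  by (simp add: truth_def truthful_report_def)

lemma truth_report_sets:
  "{t \<in> {..<T}. truth s t = RepF} = agents Friendly"
  "{t \<in> {..<T}. truth s t = RepU} = agents Unfriendly"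
  "{t \<in> {..<T}. treated_signal (truth s t) = SigH}
     = agents Friendly \<union> {t \<in> agents Contingent. s t = SigH}"
  by (auto simp: truth_by_type agents_def split: atype.splits)

lemma truth_signal_frac:
  "real (card {t \<in> {..<T}. treated_signal (truth s t) = SigH}) / real T
     = (real (card (agents Friendly)) + real (card {t \<in> agents Contingent. s t = SigH})) / real T"
  unfolding truth_report_sets
  by (subst card_Un_disjoint) (auto simp: finite_agents agents_def)

text \<open>Friendly agents are counted as \<open>h\<close>, which matches the term
  \<open>type_frac T v Friendly\<close> of the prediction; it cancels and leaves the contingent
  agents only.\<close>

lemma prediction_less_iff:
  "type_frac T v Friendly + type_frac T v Contingent * x
     < (real (card (agents Friendly)) + k) / real T
   \<longleftrightarrow> real (card (agents Contingent)) * x < k"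
proof -
  have "type_frac T v Friendly + type_frac T v Contingent * x
      = (real (card (agents Friendly)) + real (card (agents Contingent)) * x) / real T"
    by (simp add: type_frac_agents add_divide_distrib)
  then show ?thesis using T_pos by (simp add: divide_less_cancel)
qed

text \<open>A count above the larger prediction \<open>TH SigH\<close> puts all contingent
  predictions below the share of \<open>SigH\<close>, along with the friendly ones, which are 0.
  These agents make up more than half, so the median is below the share too.\<close>

lemma truthful_outcome_Accept:
  assumes maj: "real (card (agents Unfriendly)) \<le> real T / 2"
    and many: "real (card (agents Contingent)) * TH SigH
                < real (card {t \<in> agents Contingent. s t = SigH})"
  shows "outcome T (truth s) = Accept"
proof -
  let ?K = "(real (card (agents Friendly)) + real (card {t \<in> agents Contingent. s t = SigH})) / real T"
  have "real (card (agents Contingent)) * TH (s t)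
      < real (card {t \<in> agents Contingent. s t = SigH})" for t
  proof -
    have "TH (s t) \<le> TH SigH" using TH_order by (cases "s t") auto
    then have "real (card (agents Contingent)) * TH (s t) \<le> real (card (agents Contingent)) * TH SigH"
      by (intro mult_left_mono) auto
    then show ?thesis using many by linarith
  qed
  then have pred: "type_frac T v Friendly + type_frac T v Contingent * TH (s t) < ?K" for t
    by (simp add: prediction_less_iff)
  \<comment> \<open>Strict positivity is what the prediction 0 of friendly agents requires; the
    index 0 is arbitrary.\<close>
  have "0 < ?K" using prediction_range[of "s 0"] pred[of 0] unfolding atLeastAtMost_iff by linarith
  then have "agents Friendly \<union> agents Contingent \<subseteq> {t \<in> {..<T}. treated_pred (truth s t) < ?K}"
    using pred by (auto simp: truth_Friendly truth_Contingent agents_less)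
  then have "card (agents Friendly \<union> agents Contingent)
      \<le> card {t \<in> {..<T}. treated_pred (truth s t) < ?K}"
    by (intro card_mono) auto
  moreover have "card (agents Friendly \<union> agents Contingent)
      = card (agents Friendly) + card (agents Contingent)"
    by (subst card_Un_disjoint) (auto simp: finite_agents agents_def)
  \<comment> \<open>\<open>T\<close> is odd, so at most half unfriendly agents leave more than half
    others.\<close>
  moreover have "T div 2 < card (agents Friendly) + card (agents Contingent)"
  proof -
    have "2 * card (agents Unfriendly) \<le> T" using maj by linarith
    then show ?thesis using card_agents odd_T by presburger
  qed
  ultimately show ?thesis
    using maj unfolding outcome_Accept_iff[OF odd_T] truth_signal_frac truth_report_sets(1,2) by linarith
qed

text \<open>No contingent prediction is below the share, since \<open>TH SigL\<close> is the smaller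
  one, and unfriendly predictions are 1; only friendly ones, at most half, can be. Acceptance needs
  strict inequality, hence \<open>\<le>\<close> in \<open>few\<close>.\<close>

lemma truthful_outcome_Reject:
  assumes maj: "real (card (agents Friendly)) \<le> real T / 2"
    and few: "real (card {t \<in> agents Contingent. s t = SigH})
                \<le> real (card (agents Contingent)) * TH SigL"
  shows "outcome T (truth s) = Reject"
proof -
  let ?K = "(real (card (agents Friendly)) + real (card {t \<in> agents Contingent. s t = SigH})) / real T"
  have pred: "\<not> type_frac T v Friendly + type_frac T v Contingent * TH (s t) < ?K" for t
  proof -
    have "TH SigL \<le> TH (s t)" using TH_order by (cases "s t") auto
    then have "real (card (agents Contingent)) * TH SigL \<le> real (card (agents Contingent)) * TH (s t)"
      by (intro mult_left_mono) auto
    then show ?thesis unfolding prediction_less_iff using few by linarith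
  qed
  have K1: "?K \<le> 1" using prediction_range[of "s 0"] pred[of 0] unfolding atLeastAtMost_iff by linarith
  have "t \<in> agents Friendly" if "t < T" "treated_pred (truth s t) < ?K" for t
    using that(1)
  proof (cases rule: agents_cases)
    case 2
    then show ?thesis using that K1 by (simp add: truth_Unfriendly)
  next
    case 3
    then show ?thesis using that pred[of t] by (simp add: truth_Contingent)
  qed
  then have "card {t \<in> {..<T}. treated_pred (truth s t) < ?K} \<le> card (agents Friendly)"
    by (intro card_mono) (auto simp: finite_agents)
  moreover have "card (agents Friendly) \<le> T div 2" using maj by linarith
  ultimately have "outcome T (truth s) \<noteq> Accept"
    using maj unfolding outcome_Accept_iff[OF odd_T] truth_signal_frac truth_report_sets(1,2) by linarith
  then show ?thesis by (simp add: outcome_Reject_iff)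
qed

text \<open>An error needs the contingent agents' count of \<open>SigH\<close> to leave its mean: in
  \<open>H\<close> down to the prediction after \<open>SigH\<close>, in \<open>L\<close> up to the
  one after \<open>SigL\<close>. Per agent these distances are at least
  \<open>gap_const pW pS\<close>, so Hoeffding's inequality gives \<open>delta\<close>.\<close>

lemma truthful_is_informed:
  assumes majF: "real (card (agents Friendly)) \<le> real T / 2"
    and majU: "real (card (agents Unfriendly)) \<le> real T / 2"
  shows "1 - accept_prob T pS (truthful T pW pS v) WH \<le> delta"
    and "accept_prob T pS (truthful T pW pS v) WL \<le> delta"
proof -
  \<comment> \<open>Two groups of at most \<open>T div 2\<close> agents cannot exhaust an odd
    \<open>T\<close>, so a contingent agent exists and the tail bound applies.\<close>
  have "2 * card (agents Friendly) \<le> T" "2 * card (agents Unfriendly) \<le> T"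
    using majF majU by linarith+
  then have "card (agents Contingent) \<noteq> 0"
    using card_agents odd_T by presburger
  then have C: "agents Contingent \<noteq> {}" by auto
  have sub: "agents Contingent \<subseteq> {..<T}" by (auto simp: agents_less)
  have tail: "exp (- 2 * g\<^sup>2 * real (card (agents Contingent))) \<le> delta" if "gap_const pW pS \<le> g" for g
  proof -
    have "(gap_const pW pS)\<^sup>2 \<le> g\<^sup>2" using that gap_const_bounds(1) by (intro power_mono)
    then show ?thesis by (simp add: delta_def mult_right_mono)
  qed
  let ?X = "\<lambda>s. real (card {t \<in> agents Contingent. s t = SigH})"
  let ?n = "real (card (agents Contingent))"
  define g where "g = pmf (pS WH) SigH - TH SigH"
  have g: "gap_const pW pS \<le> g" "0 \<le> g" using gap_const_bounds by (auto simp: g_def)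
  have "1 - accept_prob T pS (truthful T pW pS v) WH
      = measure (measure_pmf (signals WH)) (UNIV - {s. outcome T (truth s) = Accept})"
    unfolding accept_prob_truthful by (subst measure_pmf.prob_compl[symmetric]) auto
  also have "\<dots> \<le> measure (measure_pmf (signals WH)) {s. ?X s \<le> ?n * (pmf (pS WH) SigH - g)}"
  proof (rule measure_pmf.finite_measure_mono, rule subsetI)
    fix s assume "s \<in> UNIV - {s. outcome T (truth s) = Accept}"
    then have "?X s \<le> ?n * TH SigH"
      using truthful_outcome_Accept[OF majU, of s] by fastforce
    then show "s \<in> {s. ?X s \<le> ?n * (pmf (pS WH) SigH - g)}" by (simp add: g_def)
  qed simp
  also have "\<dots> \<le> exp (- 2 * g\<^sup>2 * ?n)"
    using sub C g by (intro signal_count_tail) auto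
  also have "\<dots> \<le> delta" using g by (intro tail)
  finally show "1 - accept_prob T pS (truthful T pW pS v) WH \<le> delta" .
  define h where "h = TH SigL - pmf (pS WL) SigH"
  have h: "gap_const pW pS \<le> h" "0 \<le> h" using gap_const_bounds by (auto simp: h_def)
  have "accept_prob T pS (truthful T pW pS v) WL
      \<le> measure (measure_pmf (signals WL)) {s. ?X s \<ge> ?n * (pmf (pS WL) SigH + h)}"
    unfolding accept_prob_truthful
  proof (rule measure_pmf.finite_measure_mono, rule subsetI)
    fix s assume "s \<in> {s. outcome T (truth s) = Accept}"
    then have "?X s \<ge> ?n * TH SigL"
      using truthful_outcome_Reject[OF majF, of s] by fastforce
    then show "s \<in> {s. ?X s \<ge> ?n * (pmf (pS WL) SigH + h)}" by (simp add: h_def)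
  qed simp
  also have "\<dots> \<le> exp (- 2 * h\<^sup>2 * ?n)"
    using sub C h by (intro signal_count_tail) auto
  also have "\<dots> \<le> delta" using h by (intro tail)
  finally show "accept_prob T pS (truthful T pW pS v) WL \<le> delta" .
qed

section \<open>Stakes, utilities and the equilibrium\<close>

definition stake :: "nat \<Rightarrow> world \<Rightarrow> real" where
  "stake t n = real (v t n Accept) - real (v t n Reject)"

lemma stake_bound: "t < T \<Longrightarrow> \<bar>stake t n\<bar> \<le> real B"
  and stake_mono: "t < T \<Longrightarrow> stake t WL < stake t WH"
proof -
  assume "t < T"
  then have adm: "admissible B (v t)" by (rule admissible)
  then have "v t n Accept \<le> B" "v t n Reject \<le> B" by (auto simp: admissible_def)
  then show "\<bar>stake t n\<bar> \<le> real B" by (simp add: stake_def)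
  show "stake t WL < stake t WH" using adm by (auto simp: admissible_def stake_def)
qed

text \<open>Utilities are integers, so any strict preference is worth at least 1.\<close>

lemma stake_sign:
  "t \<in> agents Friendly \<Longrightarrow> 1 \<le> stake t n"
  "t \<in> agents Unfriendly \<Longrightarrow> stake t n \<le> - 1"
  "t \<in> agents Contingent \<Longrightarrow> stake t WL \<le> - 1"
  "t \<in> agents Contingent \<Longrightarrow> 1 \<le> stake t WH"
proof -
  show "1 \<le> stake t n" if "t \<in> agents Friendly"
  proof -
    have "v t n Reject < v t n Accept" using agents_type[OF that] by simp
    then show ?thesis by (simp add: stake_def)
  qed
  show "stake t n \<le> - 1" if "t \<in> agents Unfriendly"
  proof -
    have "v t n Accept < v t n Reject" using agents_type[OF that] by simp
    then show ?thesis by (simp add: stake_def)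
  qed
  show "stake t WL \<le> - 1" "1 \<le> stake t WH" if "t \<in> agents Contingent"
  proof -
    have "v t WL Accept < v t WL Reject" "v t WH Reject < v t WH Accept"
      using agents_type[OF that] by simp_all
    then show "stake t WL \<le> - 1" "1 \<le> stake t WH" by (simp_all add: stake_def)
  qed
qed

text \<open>Utility is affine in the acceptance probabilities, so a deviation matters only through
  the two shifts.\<close>

lemma utility_gain:
  "utility T pW pS v \<Sigma> t - utility T pW pS v (truthful T pW pS v) t
     = stake t WH * accept_shift WH \<Sigma> + stake t WL * accept_shift WL \<Sigma>"
  by (simp add: utility_def reject_prob_def stake_def algebra_simps)

text \<open>\<open>2 * real B ^ 2\<close> comes from two worlds, stakes up to \<open>B\<close> and
  shifts up to \<open>B * delta\<close>.\<close>

lemma truthful_strong_BNE: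
  "strong_BNE T pW pS v (2 * real B ^ 2 * delta) (truthful T pW pS v)"
proof -
  have False
    if D: "D \<subseteq> {..<T}" and \<Sigma>: "is_profile T \<Sigma>"
      and eq: "\<forall>t \<in> {..<T} - D. \<Sigma> t = truthful T pW pS v t"
      and weak: "\<forall>t \<in> D. utility T pW pS v \<Sigma> t \<ge> utility T pW pS v (truthful T pW pS v) t"
      and t: "t \<in> D"
        "utility T pW pS v \<Sigma> t > utility T pW pS v (truthful T pW pS v) t + 2 * real B ^ 2 * delta"
    for D \<Sigma> t
  proof -
    define x where "x = accept_shift WH \<Sigma>"
    define y where "y = accept_shift WL \<Sigma>"
    have gain: "0 \<le> stake u WH * x + stake u WL * y" if "u \<in> D" for u
      using bspec[OF weak that] utility_gain[of \<Sigma> u] unfolding x_def y_def by linarith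
    have strict: "2 * real B ^ 2 * delta < stake t WH * x + stake t WL * y"
      using t utility_gain[of \<Sigma> t] by (simp add: x_def y_def)
    have dpos: "0 \<le> delta" by (simp add: delta_def)
    have tT: "t < T" using t D by auto
    have pos: "0 < stake t WH * x + stake t WL * y"
      using strict dpos by (smt (verit) mult_nonneg_nonneg zero_le_power2)
    note prior = prior_pos[THEN less_imp_le]
    have scale: "pmf pW n * z \<le> z" if "0 \<le> z" for n z
      using that pmf_le_1[of pW n] by (simp add: mult_le_cancel_right2)
    have trange: "0 \<le> accept_prob T pS (truthful T pW pS v) n"
      "accept_prob T pS (truthful T pW pS v) n \<le> 1" for n
      using accept_prob_range[OF is_profile_truthful] by auto
    have range: "0 \<le> accept_prob T pS \<Sigma> n" "accept_prob T pS \<Sigma> n \<le> 1" for n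
      using accept_prob_range[OF \<Sigma>] by auto

    \<comment> \<open>With stakes of at least 1, a friendly member loses unless both shifts vanish,
      and then nobody gains.\<close>
    have down: "D \<inter> agents Friendly = {}" if "x \<le> 0" "y \<le> 0"
    proof (rule ccontr)
      assume "D \<inter> agents Friendly \<noteq> {}"
      then obtain u where u: "u \<in> D" "u \<in> agents Friendly" by blast
      have "stake u WH * x \<le> 1 * x" "stake u WL * y \<le> 1 * y"
        by (rule mult_right_mono_neg[OF stake_sign(1)[OF u(2)] that(1)], rule mult_right_mono_neg[OF stake_sign(1)[OF u(2)] that(2)])
      then have "x = 0" "y = 0" using gain[OF u(1)] that by linarith+
      then show False using pos by simp
    qed
    have up: "D \<inter> agents Unfriendly = {}" if "0 \<le> x" "0 \<le> y"
    proof (rule ccontr)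
      assume "D \<inter> agents Unfriendly \<noteq> {}"
      then obtain u where u: "u \<in> D" "u \<in> agents Unfriendly" by blast
      have "stake u WH * x \<le> - 1 * x" "stake u WL * y \<le> - 1 * y"
        by (rule mult_right_mono[OF stake_sign(2)[OF u(2)] that(1)], rule mult_right_mono[OF stake_sign(2)[OF u(2)] that(2)])
      then have "x = 0" "y = 0" using gain[OF u(1)] that by linarith+
      then show False using pos by simp
    qed

    show False
    proof (cases "real (card (agents Friendly)) > real T / 2")
      case True
      have one: "accept_prob T pS (truthful T pW pS v) n = 1" for n
        by (rule friendly_majority[OF is_profile_truthful, of "{}"]) (use True in auto)
      \<comment> \<open>Starting from certain acceptance, shifts only go down; by
        \<open>down\<close> the friendly majority then lies outside \<open>D\<close>.\<close>
      then have "x \<le> 0" "y \<le> 0"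
        using range prior by (auto simp: x_def y_def mult_le_0_iff)
      then have "accept_prob T pS \<Sigma> n = 1" for n
        using friendly_majority[OF \<Sigma> eq down True] by blast
      then show False using pos one by (simp add: x_def y_def)
    next
      case majF: False
      show False
      proof (cases "real (card (agents Unfriendly)) > real T / 2")
        case True
        have zero: "accept_prob T pS (truthful T pW pS v) n = 0" for n
          by (rule unfriendly_majority[OF is_profile_truthful, of "{}"]) (use True in auto)
        then have "0 \<le> x" "0 \<le> y"
          using range prior by (auto simp: x_def y_def)
        then have "accept_prob T pS \<Sigma> n = 0" for n
          using unfriendly_majority[OF \<Sigma> eq up True] by blast
        then show False using pos zero by (simp add: x_def y_def)
      next
        case majU: False
        have "1 - accept_prob T pS (truthful T pW pS v) WH \<le> delta"
          "accept_prob T pS (truthful T pW pS v) WL \<le> delta"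
          using truthful_is_informed majF majU by simp_all
        \<comment> \<open>Probabilities stay between 0 and 1, so acceptance can rise in
          \<open>H\<close> and fall in \<open>L\<close> by no more than the truthful error
          there.\<close>
        then have "pmf pW WH * (accept_prob T pS \<Sigma> WH - accept_prob T pS (truthful T pW pS v) WH)
              \<le> pmf pW WH * delta"
            "pmf pW WL * (accept_prob T pS (truthful T pW pS v) WL - accept_prob T pS \<Sigma> WL)
              \<le> pmf pW WL * delta"
          using range[of WH] range[of WL] prior by (auto intro!: mult_left_mono)
        then have xd: "x \<le> delta" and yd: "- delta \<le> y"
          using scale[OF dpos, of WH] scale[OF dpos, of WL]
          by (simp_all add: x_def y_def right_diff_distrib)
        have bounded: False if "\<bar>x\<bar> \<le> real B * delta" "\<bar>y\<bar> \<le> real B * delta"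
        proof -
          have "stake t n * z \<le> real B * (real B * delta)" if "\<bar>z\<bar> \<le> real B * delta" for n z
          proof -
            have "\<bar>stake t n\<bar> * \<bar>z\<bar> \<le> real B * (real B * delta)"
              using that stake_bound[OF tT] by (intro mult_mono) auto
            then show ?thesis by (simp flip: abs_mult)
          qed
          from this[OF that(1), of WH] this[OF that(2), of WL] show False
            using strict by (simp add: power2_eq_square)
        qed
        show False
        proof (cases "D \<inter> agents Contingent = {}")
          case False
          then obtain u where u: "u \<in> D" "u \<in> agents Contingent" by blast
          have "1 \<le> stake u WH" "stake u WH \<le> real B" "1 \<le> - stake u WL" "- stake u WL \<le> real B"
            using stake_sign(3,4)[OF u(2)] stake_bound[of u WH] stake_bound[of u WL]
              agents_less[OF u(2)] by auto
          from contingent_shift_bound[OF this _ xd yd dpos] bounded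
          show False using gain[OF u(1)] by simp
        next
          case noC: True
          \<comment> \<open>Without contingent members, a purely unfriendly coalition cannot lower
            acceptance in either world and is empty by \<open>up\<close>, against \<open>t\<close>;
            the friendly case is the mirror image.\<close>
          show False
          proof (cases "D \<subseteq> agents Unfriendly")
            case True
            then have "0 \<le> x" "0 \<le> y"
              using unfriendly_deviation[OF \<Sigma> eq] prior by (auto simp: x_def y_def)
            then show False using up t True by blast
          next
            case False
            then obtain f where f: "f \<in> D" "f \<in> agents Friendly"
              using noC D by (blast elim: agents_cases)
            show False
            proof (cases "D \<subseteq> agents Friendly")
              case True
              then have "x \<le> 0" "y \<le> 0"
                using friendly_deviation[OF \<Sigma> eq] prior by (auto simp: x_def y_def mult_le_0_iff)
              then show False using down f by blast
            next
              case False
              then obtain u where u: "u \<in> D" "u \<in> agents Unfriendly"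
                using noC D by (blast elim: agents_cases)
              have fs: "stake f WL < stake f WH" "0 < stake f WL"
                using stake_mono[of f] stake_sign(1)[OF f(2), of WL] agents_less[OF f(2)] by auto
              \<comment> \<open>Unfriendly stakes are negative, so negation reverses their order
                between the worlds, as \<open>opposed_interests\<close> expects.\<close>
              have us: "- stake u WH < - stake u WL" "0 < - stake u WH"
                using stake_mono[of u] stake_sign(2)[OF u(2), of WH] agents_less[OF u(2)] by auto
              have "- stake u WH * x + - stake u WL * y \<le> 0" using gain[OF u(1)] by simp
              from opposed_interests[OF fs us gain[OF f(1)] this] have "0 \<le> x" "y \<le> 0" .
              moreover have "1 \<le> real B"
                using stake_sign(1)[OF f(2), of WL] stake_bound[of f WL] agents_less[OF f(2)] by auto
              then have "delta \<le> real B * delta" using dpos by (simp add: mult_le_cancel_right1)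
              ultimately show False using xd yd by (intro bounded) linarith+
            qed
          qed
        qed
      qed
    qed
  qed
  then show ?thesis unfolding strong_BNE_def using is_profile_truthful by blast
qed

end

text \<open>The coalition bound \<open>2 * real B ^ 2 * delta\<close> is enlarged to the stated one;
  a larger tolerance admits fewer profitable deviations.\<close>

theorem theorem3p3:
  fixes T B :: nat
    and pW :: "world pmf"
    and pS :: "world \<Rightarrow> signal pmf"
    and v :: "nat \<Rightarrow> world \<Rightarrow> alternative \<Rightarrow> nat"
  assumes "odd T"
    and "B > 0"
    and "pmf pW WL > 0" and "pmf pW WH > 0"
    and "pmf (pS WL) SigL > pmf (pS WH) SigL"
    and "pmf (pS WH) SigH > pmf (pS WL) SigH"
    and "\<And>t. t < T \<Longrightarrow> admissible B (v t)"
  defines "c \<equiv> gap_const pW pS"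
    and "\<alpha>\<^sub>C \<equiv> type_frac T v Contingent"
  shows "strong_BNE T pW pS v
           ((2 * real B ^ 2 + 4 * real B) * exp (- 2 * c ^ 2 * \<alpha>\<^sub>C * real T))
           (truthful T pW pS v)"
proof -
  interpret wisdom_voting T B pW pS v
    using assms by unfold_locales auto
  have "\<alpha>\<^sub>C * real T = real (card (agents Contingent))"
    using T_pos by (simp add: \<alpha>\<^sub>C_def type_frac_agents)
  then have "exp (- 2 * c ^ 2 * \<alpha>\<^sub>C * real T) = delta"
    by (simp add: delta_def c_def mult.assoc)
  moreover have "2 * real B ^ 2 * delta \<le> (2 * real B ^ 2 + 4 * real B) * delta"
    by (intro mult_right_mono) (auto simp: delta_def)
  ultimately show ?thesis
    using truthful_strong_BNE unfolding strong_BNE_def by (smt (verit, best))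
qed

end
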